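(* Let $\mathbb{F}$ be a field of characteristic $p>0$ and let $P(X)\in\mathbb{F}_p(t)[X]$ be a nonzero additive polynomial. Let $q$ be a prime different from $p$. If $x\in\mathbb{F}((t^{\mathbb{Q}}))$ is a root of $P$ and $r\in\mathbb{Q}$ is such that $q$ ramifies at $r$ in $x$, then $r$ is a point of intersection of $P$.
   Context: $\mathbb{F}((t^{\mathbb{Q}}))$ is the Hahn field of generalised power series $x=\sum_{\gamma}a_\gamma t^\gamma$ with $a_\gamma\in\mathbb{F}$ and well-ordered support $\{\gamma\in\mathbb{Q}\mid a_\gamma\neq0\}$; $v$ is the $t$-adic valuation (minimum of the support, $v(0)=\infty$), and $\mathbb{F}_p(t)\subseteq \mathbb{F}((t^{\mathbb{Q}}))$ in the natural way. For $r\in\mathbb{Q}$, $x_{<r}=\sum_{\gamma<r}a_\gamma t^\gamma$. Additive polynomials: a polynomial $P$ over a field is additive if $P(X+Y)=P(X)+P(Y)$ as polynomials in $X$ and $Y$; in characteristic $p$ this means $P(X)=\sum_{i=0}^n a_iX^{p^i}$. Points of intersection: for $P(X)=\sum_{i=0}^n a_iX^{p^i}$ put $I_P=\{i\in\{0,\dots,n\}\mid a_i\neq 0\}$. For $i\in I_P$ let $\gamma_i(r)=p^ir+v(a_i)$ for $r\in\mathbb{R}$, and $\gamma_i(\infty)=\infty$. Let $J(r)=\{i\in I_P\mid \gamma_i(r)=\min_{j\in I_P}\gamma_j(r)\}$. An element $r\in\mathbb{R}\cup\{\infty\}$ is a point of intersection of $P$ if $|J(r)|>1$. Ramification: let $r$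 be in the support of $x$ and let $S$ be the support of $x_{<r}$. A prime $q$ ramifies at $r$ in $x$ if there is a positive integer $K$ such that $r=\frac{a}{bq^K}$ with $a,b$ integers coprime to $q$, and for every integer $k\ge K$ there is no element of $S$ of the form $\frac{a'}{b'q^k}$ with $a',b'$ integers coprime to $q$. *)

theory Defs
  imports
    "HOL-Computational_Algebra.Polynomial"
    "HOL-Computational_Algebra.Primes"
    "HOL-Library.Extended_Real"
begin

section \<open>Well-ordered sets of rationals\<close>

text \<open>Since \<open><\<close> is linear on the rationals, a set \<open>S\<close> is well-ordered iff \<open>wfp_on S (<)\<close>.\<close>

lemma wfp_on_rat_iff:
  "wfp_on S ((<) :: rat \<Rightarrow> rat \<Rightarrow> bool) \<longleftrightarrow>
     (\<forall>T \<subseteq> S. T \<noteq> {} \<longrightarrow> (\<exists>m\<in>T. \<forall>s\<in>T. m \<le> s))"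
  unfolding wfp_on_iff_ex_minimal by (meson leD not_le)

lemma wfp_on_rat_least:
  assumes "wfp_on S ((<) :: rat \<Rightarrow> rat \<Rightarrow> bool)" "T \<subseteq> S" "T \<noteq> {}"
  obtains m where "m \<in> T" "\<And>s. s \<in> T \<Longrightarrow> m \<le> s"
proof -
  have "\<exists>m\<in>T. \<forall>s\<in>T. m \<le> s"
    using assms(1)[unfolded wfp_on_rat_iff, rule_format, OF assms(2,3)] .
  then show ?thesis using that by auto
qed

lemma wfp_on_rat_Un:
  assumes "wfp_on S ((<) :: rat \<Rightarrow> rat \<Rightarrow> bool)" "wfp_on T (<)"
  shows "wfp_on (S \<union> T) (<)"
  unfolding wfp_on_rat_iff
proof (intro allI impI)
  fix C assume C: "C \<subseteq> S \<union> T" "C \<noteq> {}"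
  show "\<exists>m\<in>C. \<forall>s\<in>C. m \<le> s"
  proof (cases "C \<inter> S = {} \<or> C \<inter> T = {}")
    case True
    then have "C \<subseteq> S \<or> C \<subseteq> T" using C by blast
    then show ?thesis using assms C unfolding wfp_on_rat_iff by blast
  next
    case False
    obtain a where a: "a \<in> C \<inter> S" "\<And>s. s \<in> C \<inter> S \<Longrightarrow> a \<le> s"
      using wfp_on_rat_least[OF assms(1), of "C \<inter> S"] False by blast
    obtain b where b: "b \<in> C \<inter> T" "\<And>s. s \<in> C \<inter> T \<Longrightarrow> b \<le> s"
      using wfp_on_rat_least[OF assms(2), of "C \<inter> T"] False by blast
    have "min a b \<in> C" using a b by (auto simp: min_def)
    moreover have "min a b \<le> s" if "s \<in> C" for s
      using that C a(2)[of s] b(2)[of s] by (auto simp: min_le_iff_disj)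
    ultimately show ?thesis by blast
  qed
qed

lemma wfp_on_rat_UN:
  assumes "finite I" "\<And>i. i \<in> I \<Longrightarrow> wfp_on (S i) ((<) :: rat \<Rightarrow> rat \<Rightarrow> bool)"
  shows "wfp_on (\<Union>i\<in>I. S i) (<)"
  using assms
proof (induction I rule: finite_induct)
  case empty
  then show ?case by (simp add: wfp_on_rat_iff)
next
  case (insert i I)
  then show ?case using wfp_on_rat_Un[of "S i" "\<Union>i\<in>I. S i"] by auto
qed

lemma wfp_on_rat_singleton: "wfp_on {a} ((<) :: rat \<Rightarrow> rat \<Rightarrow> bool)"
  unfolding wfp_on_rat_iff
proof (intro allI impI)
  fix T assume "T \<subseteq> {a}" "T \<noteq> {}"
  then have "T = {a}" by (simp add: subset_singleton_iff)
  then show "\<exists>m\<in>T. \<forall>s\<in>T. m \<le> s" by simp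
qed

definition sumset :: "rat set \<Rightarrow> rat set \<Rightarrow> rat set"
  where "sumset A B = {a + b | a b. a \<in> A \<and> b \<in> B}"

lemma wfp_on_sumset:
  assumes A: "wfp_on A (<)" and B: "wfp_on B (<)"
  shows "wfp_on (sumset A B) (<)"
proof -
  have *: "\<exists>m\<in>C. \<forall>s\<in>C. m \<le> s"
    if "b \<in> B" "C \<subseteq> sumset A B" "a \<in> A" "a + b \<in> C"
       "\<And>a' b'. a' \<in> A \<Longrightarrow> b' \<in> B \<Longrightarrow> a' + b' \<in> C \<Longrightarrow> a \<le> a'" for b a C
    using B that
  proof (induction b arbitrary: a C rule: wfp_on_induct)
    case in_set
    show ?case by (rule that(1))
  next
    case (less b)
    show ?case
    proof (cases "\<forall>s\<in>C. a + b \<le> s")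
      case True
      then show ?thesis using less.prems by blast
    next
      case False
      define C' where "C' = {c \<in> C. c < a + b}"
      define A' where "A' = {a' \<in> A. \<exists>b'\<in>B. a' + b' \<in> C'}"
      obtain c where c: "c \<in> C'" using False by (auto simp: C'_def not_le)
      then have "c \<in> sumset A B" using less.prems(2) by (auto simp: C'_def)
      with c have "A' \<noteq> {}" by (auto simp: A'_def sumset_def)
      moreover have "A' \<subseteq> A" by (auto simp: A'_def)
      ultimately obtain a' where a': "a' \<in> A'" "\<And>s. s \<in> A' \<Longrightarrow> a' \<le> s"
        using wfp_on_rat_least[OF A, of A'] by metis
      then obtain b' where b': "b' \<in> B" "a' + b' \<in> C'" "a' \<in> A" by (auto simp: A'_def)
      have "a \<le> a'" using less.prems(5) b' by (auto simp: C'_def)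
      then have "b' < b" using b' by (auto simp: C'_def)
      moreover have "C' \<subseteq> sumset A B" using less.prems(2) by (auto simp: C'_def)
      ultimately have "\<exists>m\<in>C'. \<forall>s\<in>C'. m \<le> s"
        using b' a'(2) by (intro less.IH[of b' C' a']) (auto simp: A'_def)
      then obtain m where m: "m \<in> C'" "\<And>s. s \<in> C' \<Longrightarrow> m \<le> s" by blast
      have "m \<le> s" if "s \<in> C" for s
        using m that by (cases "s < a + b") (auto simp: C'_def)
      moreover have "m \<in> C" using m by (simp add: C'_def)
      ultimately show ?thesis by blast
    qed
  qed
  show ?thesis
    unfolding wfp_on_rat_iff
  proof (intro allI impI)
    fix C assume C: "C \<subseteq> sumset A B" "C \<noteq> {}"
    define A' where "A' = {a \<in> A. \<exists>b\<in>B. a + b \<in> C}"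
    obtain c where "c \<in> C" "c \<in> sumset A B" using C by blast
    then have "A' \<noteq> {}" by (auto simp: A'_def sumset_def)
    moreover have "A' \<subseteq> A" by (auto simp: A'_def)
    ultimately obtain a where a: "a \<in> A'" "\<And>s. s \<in> A' \<Longrightarrow> a \<le> s"
      using wfp_on_rat_least[OF A, of A'] by metis
    then obtain b where "b \<in> B" "a + b \<in> C" "a \<in> A" by (auto simp: A'_def)
    then show "\<exists>m\<in>C. \<forall>s\<in>C. m \<le> s"
      using C(1) a(2) by (intro *[of b C a]) (auto simp: A'_def)
  qed
qed

definition sum_pairs :: "rat set \<Rightarrow> rat set \<Rightarrow> rat \<Rightarrow> (rat \<times> rat) set"
  where "sum_pairs A B \<gamma> = {(\<alpha>, \<beta>). \<alpha> \<in> A \<and> \<beta> \<in> B \<and> \<alpha> + \<beta> = \<gamma>}"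

lemma finite_sum_pairs:
  assumes A: "wfp_on A (<)" and B: "wfp_on B (<)"
  shows "finite (sum_pairs A B \<gamma>)"
proof -
  define S where "S = {\<alpha> \<in> A. \<gamma> - \<alpha> \<in> B}"
  have "finite S"
  proof (cases "S = {}")
    case False
    define T where "T = {\<alpha> \<in> S. finite {\<beta> \<in> S. \<beta> \<le> \<alpha>}}"
    have SA: "S \<subseteq> A" by (auto simp: S_def)
    obtain m0 where m0: "m0 \<in> S" "\<And>s. s \<in> S \<Longrightarrow> m0 \<le> s"
      using wfp_on_rat_least[OF A SA False] by blast
    have "{\<beta> \<in> S. \<beta> \<le> m0} \<subseteq> {m0}" using m0(2) by force
    then have "m0 \<in> T" using m0 finite_subset[of _ "{m0}"] by (simp add: T_def)
    then obtain n where n: "n \<in> (\<lambda>a. \<gamma> - a) ` T" "\<And>s. s \<in> (\<lambda>a. \<gamma> - a) ` T \<Longrightarrow> n \<le> s"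
      using wfp_on_rat_least[OF B, of "(\<lambda>a. \<gamma> - a) ` T"] by (auto simp: T_def S_def)
    obtain m where m: "m \<in> T" "n = \<gamma> - m" using n(1) by blast
    have max: "s \<le> m" if "s \<in> T" for s using n(2)[of "\<gamma> - s"] that m by auto
    have "{\<beta> \<in> S. \<beta> > m} = {}"
    proof (rule ccontr)
      assume ne: "{\<beta> \<in> S. \<beta> > m} \<noteq> {}"
      have "{\<beta> \<in> S. \<beta> > m} \<subseteq> A" using SA by blast
      then obtain m' where "m' \<in> {\<beta> \<in> S. \<beta> > m}" "\<And>s. s \<in> {\<beta> \<in> S. \<beta> > m} \<Longrightarrow> m' \<le> s"
        using wfp_on_rat_least[OF A _ ne] by metis
      then have m': "m' \<in> S" "m' > m" "\<And>s. s \<in> S \<Longrightarrow> s > m \<Longrightarrow> m' \<le> s" by auto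
      have "{\<beta> \<in> S. \<beta> \<le> m'} \<subseteq> insert m' {\<beta> \<in> S. \<beta> \<le> m}"
      proof
        fix s assume "s \<in> {\<beta> \<in> S. \<beta> \<le> m'}"
        then show "s \<in> insert m' {\<beta> \<in> S. \<beta> \<le> m}"
          using m'(3)[of s] by (cases "s \<le> m") auto
      qed
      moreover have "finite (insert m' {\<beta> \<in> S. \<beta> \<le> m})" using m(1) by (simp add: T_def)
      ultimately have "finite {\<beta> \<in> S. \<beta> \<le> m'}" by (rule finite_subset)
      then have "m' \<in> T" using m'(1) by (simp add: T_def)
      then show False using max[of m'] m' by simp
    qed
    then have "S \<subseteq> {\<beta> \<in> S. \<beta> \<le> m}" by (auto simp: not_less)
    moreover have "finite {\<beta> \<in> S. \<beta> \<le> m}" using m(1) by (simp add: T_def)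
    ultimately show ?thesis by (rule finite_subset)
  qed simp
  moreover have "sum_pairs A B \<gamma> \<subseteq> (\<lambda>\<alpha>. (\<alpha>, \<gamma> - \<alpha>)) ` S"
    by (auto simp: sum_pairs_def S_def image_iff)
  ultimately show ?thesis by (meson finite_imageI finite_subset)
qed


section \<open>The Hahn field\<close>

text \<open>\<open>'a hahn\<close> is the field of generalised power series over \<open>'a\<close> with exponents in the rationals.\<close>

typedef (overloaded) 'a hahn = "{f :: rat \<Rightarrow> 'a::zero. wfp_on {\<gamma>. f \<gamma> \<noteq> 0} (<)}"
  morphisms hahn_coeff Abs_hahn
  by (rule exI[of _ "\<lambda>_. 0"]) (simp add: wfp_on_rat_iff)

setup_lifting type_definition_hahn

definition hahn_supp :: "'a::zero hahn \<Rightarrow> rat set"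
  where "hahn_supp x = {\<gamma>. hahn_coeff x \<gamma> \<noteq> 0}"

lemma wfp_on_hahn_supp: "wfp_on (hahn_supp x) (<)"
  unfolding hahn_supp_def using hahn_coeff[of x] by simp

lemma hahn_eqI: "(\<And>\<gamma>. hahn_coeff x \<gamma> = hahn_coeff y \<gamma>) \<Longrightarrow> x = y"
  by (simp add: hahn_coeff_inject[symmetric] fun_eq_iff)

lift_definition hahn_monom :: "'a::zero \<Rightarrow> rat \<Rightarrow> 'a hahn"
  is "\<lambda>a \<gamma> \<delta>. if \<delta> = \<gamma> then a else 0"
  by (rule wfp_on_subset[OF wfp_on_rat_singleton]) auto

lift_definition hahn_truncate :: "'a::zero hahn \<Rightarrow> rat \<Rightarrow> 'a hahn"
  is "\<lambda>f r \<gamma>. if \<gamma> < r then f \<gamma> else 0"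
  by (erule wfp_on_subset) auto

lemma hahn_coeff_monom [simp]: "hahn_coeff (hahn_monom a \<gamma>) \<delta> = (if \<delta> = \<gamma> then a else 0)"
  by transfer simp

lemma hahn_coeff_truncate [simp]:
  "hahn_coeff (hahn_truncate x r) \<gamma> = (if \<gamma> < r then hahn_coeff x \<gamma> else 0)"
  by transfer simp

instantiation hahn :: (field) "{zero, one, plus, minus, uminus, times}"
begin

lift_definition zero_hahn :: "'a hahn" is "\<lambda>_. 0"
  by (simp add: wfp_on_rat_iff)

definition one_hahn :: "'a hahn" where "one_hahn = hahn_monom 1 0"

lift_definition plus_hahn :: "'a hahn \<Rightarrow> 'a hahn \<Rightarrow> 'a hahn" is "\<lambda>f g \<gamma>. f \<gamma> + g \<gamma>"
  by (rule wfp_on_subset, erule (1) wfp_on_rat_Un) auto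

lift_definition minus_hahn :: "'a hahn \<Rightarrow> 'a hahn \<Rightarrow> 'a hahn" is "\<lambda>f g \<gamma>. f \<gamma> - g \<gamma>"
  by (rule wfp_on_subset, erule (1) wfp_on_rat_Un) auto

lift_definition uminus_hahn :: "'a hahn \<Rightarrow> 'a hahn" is "\<lambda>f \<gamma>. - f \<gamma>"
  by (erule wfp_on_subset) auto

lift_definition times_hahn :: "'a hahn \<Rightarrow> 'a hahn \<Rightarrow> 'a hahn"
  is "\<lambda>f g \<gamma>. \<Sum>(\<alpha>, \<beta>) \<in> sum_pairs {\<alpha>. f \<alpha> \<noteq> 0} {\<beta>. g \<beta> \<noteq> 0} \<gamma>. f \<alpha> * g \<beta>"
proof -
  fix f g :: "rat \<Rightarrow> 'a"
  assume "wfp_on {\<gamma>. f \<gamma> \<noteq> 0} (<)" "wfp_on {\<gamma>. g \<gamma> \<noteq> 0} (<)"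
  then have "wfp_on (sumset {\<gamma>. f \<gamma> \<noteq> 0} {\<gamma>. g \<gamma> \<noteq> 0}) (<)" by (rule wfp_on_sumset)
  then show "wfp_on {\<gamma>. (\<Sum>(\<alpha>, \<beta>) \<in> sum_pairs {\<alpha>. f \<alpha> \<noteq> 0} {\<beta>. g \<beta> \<noteq> 0} \<gamma>. f \<alpha> * g \<beta>) \<noteq> 0} (<)"
    by (rule wfp_on_subset)
       (fastforce simp: sumset_def sum_pairs_def elim!: sum.not_neutral_contains_not_neutral)
qed

instance ..

end

lemma hahn_coeff_0 [simp]: "hahn_coeff 0 \<gamma> = 0"
  by transfer simp
lemma hahn_coeff_1: "hahn_coeff 1 \<gamma> = (if \<gamma> = 0 then 1 else 0)"
  by (simp add: one_hahn_def)
lemma hahn_coeff_add [simp]: "hahn_coeff (x + y) \<gamma> = hahn_coeff x \<gamma> + hahn_coeff y \<gamma>"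
  by transfer simp
lemma hahn_coeff_diff [simp]: "hahn_coeff (x - y) \<gamma> = hahn_coeff x \<gamma> - hahn_coeff y \<gamma>"
  by transfer simp
lemma hahn_coeff_uminus [simp]: "hahn_coeff (- x) \<gamma> = - hahn_coeff x \<gamma>"
  by transfer simp
lemma hahn_coeff_mult:
  "hahn_coeff (x * y) \<gamma> =
     (\<Sum>(\<alpha>, \<beta>) \<in> sum_pairs (hahn_supp x) (hahn_supp y) \<gamma>. hahn_coeff x \<alpha> * hahn_coeff y \<beta>)"
  unfolding hahn_supp_def by transfer simp

lemma hahn_coeff_mult_superset:
  assumes "wfp_on A (<)" "wfp_on B (<)" "hahn_supp x \<subseteq> A" "hahn_supp y \<subseteq> B"
  shows "hahn_coeff (x * y) \<gamma> = (\<Sum>(\<alpha>, \<beta>) \<in> sum_pairs A B \<gamma>. hahn_coeff x \<alpha> * hahn_coeff y \<beta>)"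
  unfolding hahn_coeff_mult
proof (rule sum.mono_neutral_left)
  show "finite (sum_pairs A B \<gamma>)" using assms by (intro finite_sum_pairs)
  show "sum_pairs (hahn_supp x) (hahn_supp y) \<gamma> \<subseteq> sum_pairs A B \<gamma>"
    using assms by (auto simp: sum_pairs_def)
qed (auto simp: sum_pairs_def hahn_supp_def)

lemma hahn_supp_mult: "hahn_supp (x * y) \<subseteq> sumset (hahn_supp x) (hahn_supp y)"
proof
  fix \<gamma> assume "\<gamma> \<in> hahn_supp (x * y)"
  then have "sum_pairs (hahn_supp x) (hahn_supp y) \<gamma> \<noteq> {}"
    unfolding hahn_supp_def[of "x * y"] by (auto simp: hahn_coeff_mult)
  then show "\<gamma> \<in> sumset (hahn_supp x) (hahn_supp y)"
    by (auto simp: sum_pairs_def sumset_def)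
qed

lemma hahn_coeff_monom_mult:
  "hahn_coeff (hahn_monom a g * x) \<gamma> = a * hahn_coeff x (\<gamma> - g)"
proof -
  have "hahn_coeff (hahn_monom a g * x) \<gamma> =
     (\<Sum>(\<alpha>, \<beta>) \<in> sum_pairs {g} (insert (\<gamma> - g) (hahn_supp x)) \<gamma>. hahn_coeff (hahn_monom a g) \<alpha> * hahn_coeff x \<beta>)"
    using wfp_on_rat_Un[OF wfp_on_rat_singleton wfp_on_hahn_supp[of x], of "\<gamma> - g"]
    by (intro hahn_coeff_mult_superset wfp_on_rat_singleton) (auto simp: hahn_supp_def)
  also have "sum_pairs {g} (insert (\<gamma> - g) (hahn_supp x)) \<gamma> = {(g, \<gamma> - g)}"
    by (auto simp: sum_pairs_def)
  finally show ?thesis by simp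
qed

lemma hahn_mult_comm: "x * y = y * (x :: 'a::field hahn)"
  by (rule hahn_eqI, unfold hahn_coeff_mult,
      rule sum.reindex_bij_witness[of _ prod.swap prod.swap])
     (auto simp: sum_pairs_def mult.commute add.commute)

lemma hahn_mult_assoc: "x * y * z = x * (y * (z :: 'a::field hahn))"
proof (rule hahn_eqI)
  fix \<gamma>
  let ?X = "hahn_supp x" and ?Y = "hahn_supp y" and ?Z = "hahn_supp z"
  let ?x = "hahn_coeff x" and ?y = "hahn_coeff y" and ?z = "hahn_coeff z"
  note wf = wfp_on_hahn_supp[of x] wfp_on_hahn_supp[of y] wfp_on_hahn_supp[of z]
  have XY: "wfp_on (sumset ?X ?Y) (<)" and YZ: "wfp_on (sumset ?Y ?Z) (<)"
    using wf by (auto intro: wfp_on_sumset)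
  have "hahn_coeff (x * y * z) \<gamma> =
    (\<Sum>(\<delta>, c) \<in> sum_pairs (sumset ?X ?Y) ?Z \<gamma>. hahn_coeff (x * y) \<delta> * ?z c)"
    using XY wf hahn_supp_mult by (intro hahn_coeff_mult_superset) auto
  also have "\<dots> = (\<Sum>d \<in> sum_pairs (sumset ?X ?Y) ?Z \<gamma>.
      \<Sum>e \<in> sum_pairs ?X ?Y (fst d). ?x (fst e) * ?y (snd e) * ?z (snd d))"
    by (intro sum.cong) (auto simp: hahn_coeff_mult sum_distrib_right case_prod_unfold)
  also have "\<dots> = (\<Sum>(d, e) \<in> (SIGMA d:sum_pairs (sumset ?X ?Y) ?Z \<gamma>. sum_pairs ?X ?Y (fst d)).
      ?x (fst e) * ?y (snd e) * ?z (snd d))"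
    by (intro sum.Sigma ballI finite_sum_pairs XY wf)
  also have "\<dots> = (\<Sum>(d, e) \<in> (SIGMA d:sum_pairs ?X (sumset ?Y ?Z) \<gamma>. sum_pairs ?Y ?Z (snd d)).
      ?x (fst d) * (?y (fst e) * ?z (snd e)))"
    by (rule sum.reindex_bij_witness[of _
          "\<lambda>((a, _), (b, c)). ((a + b, c), (a, b))" "\<lambda>((_, c), (a, b)). ((a, b + c), (b, c))"])
       (auto simp: sum_pairs_def sumset_def mult.assoc add.assoc)
  also have "\<dots> = (\<Sum>d \<in> sum_pairs ?X (sumset ?Y ?Z) \<gamma>.
      \<Sum>e \<in> sum_pairs ?Y ?Z (snd d). ?x (fst d) * (?y (fst e) * ?z (snd e)))"
    by (rule sum.Sigma[symmetric]; intro ballI finite_sum_pairs YZ wf)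
  also have "\<dots> = (\<Sum>(a, \<delta>) \<in> sum_pairs ?X (sumset ?Y ?Z) \<gamma>. ?x a * hahn_coeff (y * z) \<delta>)"
    by (intro sum.cong) (auto simp: hahn_coeff_mult sum_distrib_left case_prod_unfold)
  also have "\<dots> = hahn_coeff (x * (y * z)) \<gamma>"
    using YZ wf hahn_supp_mult by (intro hahn_coeff_mult_superset[symmetric]) auto
  finally show "hahn_coeff (x * y * z) \<gamma> = hahn_coeff (x * (y * z)) \<gamma>" .
qed

instance hahn :: (field) comm_ring_1
proof
  fix x y z :: "'a hahn"
  show "x + y + z = x + (y + z)" by (rule hahn_eqI) simp
  show "x + y = y + x" by (rule hahn_eqI) simp
  show "0 + x = x" by (rule hahn_eqI) simp
  show "- x + x = 0" by (rule hahn_eqI) simp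
  show "x - y = x + - y" by (rule hahn_eqI) simp
  show "x * y * z = x * (y * z)" by (rule hahn_mult_assoc)
  show "x * y = y * x" by (rule hahn_mult_comm)
  show "1 * x = x" by (rule hahn_eqI) (simp add: one_hahn_def hahn_coeff_monom_mult)
  show "(0 :: 'a hahn) \<noteq> 1"
    by (metis hahn_coeff_0 hahn_coeff_1 zero_neq_one)
  show "(x + y) * z = x * z + y * z"
  proof (rule hahn_eqI)
    fix \<gamma>
    let ?A = "hahn_supp x \<union> hahn_supp y" and ?B = "hahn_supp z"
    have wf: "wfp_on ?A (<)" "wfp_on ?B (<)" by (auto intro: wfp_on_rat_Un wfp_on_hahn_supp)
    have "hahn_supp (x + y) \<subseteq> ?A" by (auto simp: hahn_supp_def)
    then show "hahn_coeff ((x + y) * z) \<gamma> = hahn_coeff (x * z + y * z) \<gamma>"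
      using hahn_coeff_mult_superset[OF wf, of "x + y" z \<gamma>]
        hahn_coeff_mult_superset[OF wf, of x z \<gamma>] hahn_coeff_mult_superset[OF wf, of y z \<gamma>]
      by (simp add: sum.distrib[symmetric] case_prod_unfold distrib_right)
  qed
qed

lemma hahn_coeff_sum [simp]: "hahn_coeff (sum f A) \<gamma> = (\<Sum>i\<in>A. hahn_coeff (f i) \<gamma>)"
  by (induction A rule: infinite_finite_induct) auto

lemma hahn_coeff_power_eq_0:
  assumes "\<And>\<gamma>. \<gamma> \<in> hahn_supp e \<Longrightarrow> \<delta> \<le> \<gamma>" "\<gamma> < of_nat n * \<delta>"
  shows "hahn_coeff (e ^ n) \<gamma> = 0"
  using assms(2)
proof (induction n arbitrary: \<gamma>)
  case 0
  then show ?case by (simp add: hahn_coeff_1)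
next
  case (Suc n)
  show ?case
  proof (rule ccontr)
    assume "hahn_coeff (e ^ Suc n) \<gamma> \<noteq> 0"
    then have "\<gamma> \<in> sumset (hahn_supp e) (hahn_supp (e ^ n))"
      using hahn_supp_mult[of e "e ^ n"] by (auto simp: hahn_supp_def)
    then obtain a b where ab: "\<gamma> = a + b" "a \<in> hahn_supp e" "b \<in> hahn_supp (e ^ n)"
      by (auto simp: sumset_def)
    then have "\<delta> \<le> a" "of_nat n * \<delta> \<le> b"
      using assms(1) Suc.IH[of b] by (auto simp: hahn_supp_def not_less[symmetric])
    then show False using ab Suc.prems by (simp add: algebra_simps)
  qed
qed

lemma hahn_one_minus_inverse:
  fixes e :: "'a::field hahn"
  assumes "\<delta> > 0" and e: "\<And>\<gamma>. \<gamma> \<in> hahn_supp e \<Longrightarrow> \<delta> \<le> \<gamma>"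
  shows "\<exists>y. (1 - e) * y = 1"
proof -
  define N where "N \<gamma> = nat \<lceil>\<gamma> / \<delta>\<rceil>" for \<gamma>
  define F where "F \<gamma> = (\<Sum>n\<le>N \<gamma>. hahn_coeff (e ^ n) \<gamma>)" for \<gamma>
  have N: "\<gamma> < of_nat n * \<delta>" if "n > N \<gamma>" for \<gamma> n
  proof -
    have "\<gamma> / \<delta> \<le> of_nat (N \<gamma>)" unfolding N_def by (metis of_nat_ceiling)
    also have "\<dots> < of_nat n" using that by simp
    finally show ?thesis using assms(1) by (simp add: divide_less_eq)
  qed
  have F: "F \<gamma> = (\<Sum>n\<le>M. hahn_coeff (e ^ n) \<gamma>)" if "N \<gamma> \<le> M" for \<gamma> M
    unfolding F_def
  proof (rule sum.mono_neutral_left)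
    show "\<forall>i\<in>{..M} - {..N \<gamma>}. hahn_coeff (e ^ i) \<gamma> = 0"
      by (auto intro!: hahn_coeff_power_eq_0[where \<delta> = \<delta>] e N)
  qed (use that in auto)
  have N_mono: "N a \<le> N b" if "a \<le> b" for a b
    unfolding N_def using that assms(1) by (intro nat_mono ceiling_mono divide_right_mono) auto
  have wf: "wfp_on {\<gamma>. F \<gamma> \<noteq> 0} (<)"
    unfolding wfp_on_rat_iff
  proof (intro allI impI)
    fix C assume C: "C \<subseteq> {\<gamma>. F \<gamma> \<noteq> 0}" "C \<noteq> {}"
    then obtain c where c: "c \<in> C" by blast
    have "wfp_on (\<Union>n\<in>{..N c}. hahn_supp (e ^ n)) (<)"
      by (intro wfp_on_rat_UN wfp_on_hahn_supp) auto
    moreover have "{\<gamma> \<in> C. \<gamma> \<le> c} \<subseteq> (\<Union>n\<in>{..N c}. hahn_supp (e ^ n))"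
    proof
      fix \<gamma> assume "\<gamma> \<in> {\<gamma> \<in> C. \<gamma> \<le> c}"
      then have "F \<gamma> \<noteq> 0" "N \<gamma> \<le> N c" using C N_mono by auto
      then have "(\<Sum>n\<le>N c. hahn_coeff (e ^ n) \<gamma>) \<noteq> 0" using F by simp
      then show "\<gamma> \<in> (\<Union>n\<in>{..N c}. hahn_supp (e ^ n))"
        by (auto simp: hahn_supp_def elim!: sum.not_neutral_contains_not_neutral)
    qed
    ultimately obtain m where m: "m \<in> {\<gamma> \<in> C. \<gamma> \<le> c}" "\<And>s. s \<in> {\<gamma> \<in> C. \<gamma> \<le> c} \<Longrightarrow> m \<le> s"
      using wfp_on_rat_least c by (metis (mono_tags, lifting) empty_iff mem_Collect_eq order_refl)
    have "m \<le> s" if "s \<in> C" for s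
      using m that by (cases "s \<le> c") auto
    then show "\<exists>m\<in>C. \<forall>s\<in>C. m \<le> s" using m(1) by blast
  qed
  define y where "y = Abs_hahn F"
  have y: "hahn_coeff y = F" unfolding y_def using wf by (intro Abs_hahn_inverse) simp
  have "(1 - e) * y = 1"
  proof (rule hahn_eqI)
    fix \<gamma>
    define s where "s = (\<Sum>n\<le>N \<gamma>. e ^ n)"
    have "hahn_coeff ((1 - e) * (y - s)) \<gamma> = 0"
    proof (rule ccontr)
      assume "hahn_coeff ((1 - e) * (y - s)) \<gamma> \<noteq> 0"
      then have "\<gamma> \<in> sumset (hahn_supp (1 - e)) (hahn_supp (y - s))"
        using hahn_supp_mult[of "1 - e" "y - s"] by (auto simp: hahn_supp_def)
      then obtain a b where ab: "\<gamma> = a + b" "a \<in> hahn_supp (1 - e)" "b \<in> hahn_supp (y - s)"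
        by (auto simp: sumset_def)
      have "a = 0 \<or> a \<in> hahn_supp e"
        using ab(2) by (auto simp: hahn_supp_def hahn_coeff_1 split: if_splits)
      then have "0 \<le> a" using e[of a] assms(1) by auto
      then have "N b \<le> N \<gamma>" using ab N_mono by simp
      then have "hahn_coeff (y - s) b = 0" by (simp add: y s_def F)
      then show False using ab(3) by (simp add: hahn_supp_def)
    qed
    moreover have "(1 - e) * s = 1 - e ^ Suc (N \<gamma>)"
      unfolding s_def by (rule sum_gp_basic)
    moreover have "hahn_coeff (e ^ Suc (N \<gamma>)) \<gamma> = 0"
      by (intro hahn_coeff_power_eq_0[where \<delta> = \<delta>] e N) auto
    moreover have "(1 - e) * y = (1 - e) * (y - s) + (1 - e) * s" by (simp add: algebra_simps)
    ultimately show "hahn_coeff ((1 - e) * y) \<gamma> = hahn_coeff 1 \<gamma>"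
      by (simp del: power_Suc)
  qed
  then show ?thesis by blast
qed

lemma hahn_ex_inverse:
  fixes x :: "'a::field hahn"
  assumes "x \<noteq> 0"
  shows "\<exists>y. x * y = 1"
proof -
  have ne: "hahn_supp x \<noteq> {}"
    using assms by (auto simp: hahn_supp_def intro: hahn_eqI)
  obtain g where g: "g \<in> hahn_supp x" "\<And>s. s \<in> hahn_supp x \<Longrightarrow> g \<le> s"
    using wfp_on_rat_least[OF wfp_on_hahn_supp order_refl ne] by blast
  define a where "a = hahn_coeff x g"
  have a: "a \<noteq> 0" using g by (simp add: a_def hahn_supp_def)
  define u where "u = hahn_monom (inverse a) (- g)"
  define e where "e = 1 - u * x"
  have coeff_e: "hahn_coeff e \<gamma> = (if \<gamma> = 0 then 1 else 0) - inverse a * hahn_coeff x (\<gamma> + g)" for \<gamma>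
    by (simp add: e_def u_def hahn_coeff_monom_mult hahn_coeff_1)
  have pos: "\<gamma> > 0" if "\<gamma> \<in> hahn_supp e" for \<gamma>
  proof -
    have *: "hahn_coeff e \<gamma> \<noteq> 0" using that by (simp add: hahn_supp_def)
    have "\<gamma> \<noteq> 0" using * a by (auto simp: coeff_e a_def[symmetric])
    with * have "\<gamma> + g \<in> hahn_supp x" by (auto simp: coeff_e hahn_supp_def)
    then show ?thesis using g(2)[of "\<gamma> + g"] \<open>\<gamma> \<noteq> 0\<close> by simp
  qed
  obtain \<delta> where "\<delta> > 0" "\<And>\<gamma>. \<gamma> \<in> hahn_supp e \<Longrightarrow> \<delta> \<le> \<gamma>"
  proof (cases "hahn_supp e = {}")
    case True
    then show ?thesis using that[of 1] by simp
  next
    case False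
    then show ?thesis
      using wfp_on_rat_least[OF wfp_on_hahn_supp order_refl False] pos that by metis
  qed
  then obtain y where "(1 - e) * y = 1" using hahn_one_minus_inverse by blast
  then have "x * (u * y) = 1" by (simp add: e_def ac_simps)
  then show ?thesis by blast
qed

instantiation hahn :: (field) field
begin

definition inverse_hahn :: "'a hahn \<Rightarrow> 'a hahn"
  where "inverse_hahn x = (if x = 0 then 0 else SOME y. x * y = 1)"

definition divide_hahn :: "'a hahn \<Rightarrow> 'a hahn \<Rightarrow> 'a hahn"
  where "divide_hahn x y = x * inverse y"

instance
proof
  fix x y :: "'a hahn"
  show "x \<noteq> 0 \<Longrightarrow> inverse x * x = 1"
    using someI_ex[OF hahn_ex_inverse[of x]] by (simp add: inverse_hahn_def mult.commute)
  show "x div y = x * inverse y" by (rule divide_hahn_def)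
  show "inverse (0 :: 'a hahn) = 0" by (simp add: inverse_hahn_def)
qed

end

definition hahn_val :: "'a::field hahn \<Rightarrow> ereal"
  where "hahn_val x = (if x = 0 then \<infinity> else ereal (of_rat (LEAST \<gamma>. \<gamma> \<in> hahn_supp x)))"

definition hahn_t :: "'a::field hahn"
  where "hahn_t = hahn_monom 1 1"

text \<open>
  In characteristic \<open>p > 0\<close> the set \<open>\<int>\<close> of integer multiples of 1 in the Hahn field is the
  prime field with \<open>p\<close> elements, so that the following is the image of the field of rational
  functions in \<open>t\<close> over it. (\<open>poly g hahn_t\<close> is nonzero for \<open>g \<noteq> 0\<close>, as \<open>t\<close> is transcendental.)
\<close>

definition Fp_t :: "'a::field hahn set"
  where "Fp_t = {poly f hahn_t / poly g hahn_t | f g.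
                   g \<noteq> 0 \<and> (\<forall>i. coeff f i \<in> \<int>) \<and> (\<forall>i. coeff g i \<in> \<int>)}"


section \<open>Additive polynomials and their points of intersection\<close>

text \<open>
  \<open>P(X + Y) = P(X) + P(Y)\<close> as an identity of polynomials in the variable \<open>Y\<close> over the ring of
  polynomials in the variable \<open>X\<close>: here \<open>[:[:0, 1:], 1:]\<close> is \<open>X + Y\<close>, \<open>[:P:]\<close> is \<open>P(X)\<close>, and
  \<open>map_poly (\<lambda>a. [:a:]) P\<close> is \<open>P(Y)\<close>.
\<close>

definition additive_poly :: "'b::comm_ring_1 poly \<Rightarrow> bool"
  where "additive_poly P \<longleftrightarrow>
    pcompose (map_poly (\<lambda>a. [:a:]) P) [:[:0, 1:], 1:] = [:P:] + map_poly (\<lambda>a. [:a:]) P"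

text \<open>
  For an additive polynomial \<open>P\<close> in characteristic \<open>p\<close>, the coefficient \<open>a\<^sub>i\<close> of \<open>X\<close> to the power
  \<open>p ^ i\<close> is \<open>coeff P (p ^ i)\<close>; the set of indices below is finite as \<open>p \<ge> 2\<close>. Elements of
  \<open>\<real> \<union> {\<infinity>}\<close> are extended reals other than \<open>-\<infinity>\<close>. As \<open>p ^ i > 0\<close> and the coefficient is nonzero
  for \<open>i \<in> index_set p P\<close>, the arithmetic of \<open>ereal\<close> gives \<open>monomial_val p P i \<infinity> = \<infinity>\<close>.
\<close>

definition index_set :: "nat \<Rightarrow> 'a::field hahn poly \<Rightarrow> nat set"
  where "index_set p P = {i. coeff P (p ^ i) \<noteq> 0}"

definition monomial_val :: "nat \<Rightarrow> 'a::field hahn poly \<Rightarrow> nat \<Rightarrow> ereal \<Rightarrow> ereal"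
  where "monomial_val p P i r = ereal (of_nat (p ^ i)) * r + hahn_val (coeff P (p ^ i))"

definition min_indices :: "nat \<Rightarrow> 'a::field hahn poly \<Rightarrow> ereal \<Rightarrow> nat set"
  where "min_indices p P r =
    {i \<in> index_set p P. monomial_val p P i r = Min ((\<lambda>j. monomial_val p P j r) ` index_set p P)}"

definition point_of_intersection :: "nat \<Rightarrow> 'a::field hahn poly \<Rightarrow> ereal \<Rightarrow> bool"
  where "point_of_intersection p P r \<longleftrightarrow> r \<noteq> -\<infinity> \<and> card (min_indices p P r) > 1"


section \<open>Ramification\<close>

definition has_exact_denom_power :: "nat \<Rightarrow> nat \<Rightarrow> rat \<Rightarrow> bool"
  where "has_exact_denom_power q k s \<longleftrightarrow>
    (\<exists>a b :: int. coprime a (int q) \<and> coprime b (int q) \<and>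
       s = of_int a / (of_int b * of_nat q ^ k))"

definition ramifies_at :: "nat \<Rightarrow> rat \<Rightarrow> 'a::field hahn \<Rightarrow> bool"
  where "ramifies_at q r x \<longleftrightarrow>
    r \<in> hahn_supp x \<and>
    (\<exists>K>0. has_exact_denom_power q K r \<and>
       (\<forall>k\<ge>K. \<not> (\<exists>s \<in> hahn_supp (hahn_truncate x r). has_exact_denom_power q k s)))"

end

theory Submission
  imports Defs
begin

text \<open>
  Restricting a generalised power series to a set \<open>C\<close> of exponents is additive. If \<open>C\<close> is stable
  under integer translations, it commutes with multiplication by series with integral support,
  hence with multiplication by elements of \<open>\<F>\<^sub>p(t)\<close>; and since Frobenius acts exponent by exponent
  (\<open>hahn_coeff_power_CHAR\<close>), it commutes with \<open>x \<mapsto> x ^ (p ^ i)\<close> as soon as \<open>C\<close> is stable under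
  multiplication and division by \<open>p\<close>. The monomials of an additive polynomial have degree a power of
  \<open>p\<close> (\<open>additive_poly_coeff_eq_0\<close>), so for a set \<open>C\<close> with both kinds of stability the restriction of
  a root of an additive polynomial \<open>P\<close> over \<open>\<F>\<^sub>p(t)\<close> is again a root (\<open>poly_hahn_restrict\<close>).

  Let \<open>q\<close> ramify at \<open>r\<close> in the root \<open>x\<close>, with exponent \<open>K\<close>, and let \<open>C\<close> consist of the rationals whose
  denominator is divisible by \<open>q ^ K\<close>. As \<open>K > 0\<close> and \<open>q \<noteq> p\<close>, this set has the required stability.
  By ramification \<open>r\<close> is the least exponent of \<open>x\<close> lying in \<open>C\<close>, so the restriction of \<open>x\<close> to \<open>C\<close>
  is a root of \<open>P\<close> of valuation \<open>r\<close>. At such a root the lowest terms of the monomials of \<open>P\<close> must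
  cancel, so the minimal valuation is attained by at least two monomials
  (\<open>point_of_intersection_root\<close>); that is, \<open>r\<close> is a point of intersection.
\<close>

section \<open>Lowest exponents\<close>

definition lowest_exponent :: "'a::zero hahn \<Rightarrow> rat \<Rightarrow> bool"
  where "lowest_exponent x m \<longleftrightarrow> m \<in> hahn_supp x \<and> (\<forall>s\<in>hahn_supp x. m \<le> s)"

lemma hahn_supp_iff: "\<gamma> \<in> hahn_supp x \<longleftrightarrow> hahn_coeff x \<gamma> \<noteq> 0"
  by (simp add: hahn_supp_def)

lemma lowest_exponent_exists:
  fixes x :: "'a::field hahn"
  assumes "x \<noteq> 0"
  obtains m where "lowest_exponent x m"
proof -
  have "hahn_supp x \<noteq> {}"
    using assms by (auto simp: hahn_supp_def intro: hahn_eqI)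
  then show ?thesis
    using wfp_on_rat_least[OF wfp_on_hahn_supp order_refl, of x] that
    by (metis lowest_exponent_def)
qed

lemma hahn_val_lowest_exponent:
  fixes x :: "'a::field hahn"
  assumes "lowest_exponent x m"
  shows "hahn_val x = ereal (of_rat m)"
proof -
  have "x \<noteq> 0" using assms by (auto simp: lowest_exponent_def hahn_supp_iff)
  moreover have "(LEAST \<gamma>. \<gamma> \<in> hahn_supp x) = m"
    using assms by (intro Least_equality) (auto simp: lowest_exponent_def)
  ultimately show ?thesis by (simp add: hahn_val_def)
qed

lemma lowest_exponent_1: "lowest_exponent (1 :: 'a::field hahn) 0"
  by (auto simp: lowest_exponent_def hahn_supp_iff hahn_coeff_1 split: if_splits)

lemma lowest_exponent_mult:
  fixes x y :: "'a::field hahn"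
  assumes x: "lowest_exponent x a" and y: "lowest_exponent y b"
  shows "lowest_exponent (x * y) (a + b)"
proof -
  have "sum_pairs (hahn_supp x) (hahn_supp y) (a + b) = {(a, b)}"
    using x y by (force simp: sum_pairs_def lowest_exponent_def)
  then have "hahn_coeff (x * y) (a + b) = hahn_coeff x a * hahn_coeff y b"
    by (simp add: hahn_coeff_mult)
  moreover have "a + b \<le> s" if "s \<in> hahn_supp (x * y)" for s
    using that x y hahn_supp_mult[of x y]
    by (force simp: sumset_def lowest_exponent_def intro: add_mono)
  ultimately show ?thesis using x y by (auto simp: lowest_exponent_def hahn_supp_iff)
qed

lemma lowest_exponent_power:
  fixes x :: "'a::field hahn"
  assumes "lowest_exponent x a"
  shows "lowest_exponent (x ^ n) (of_nat n * a)"
proof (induction n)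
  case 0
  then show ?case by (simp add: lowest_exponent_1)
next
  case (Suc n)
  then show ?case
    using lowest_exponent_mult[OF assms Suc.IH] by (simp add: algebra_simps)
qed

text \<open>
  If a single monomial of \<open>P\<close> had minimal valuation at \<open>y\<close>, its lowest term would survive in the
  value of \<open>P\<close> at \<open>y\<close>.
\<close>

lemma point_of_intersection_root:
  fixes P :: "'a::field hahn poly"
  assumes powers: "\<And>y. poly P y = (\<Sum>i\<in>index_set p P. coeff P (p ^ i) * y ^ (p ^ i))"
    and fin: "finite (index_set p P)" and ne: "index_set p P \<noteq> {}"
    and root: "poly P y = 0" and y: "lowest_exponent y m"
  shows "point_of_intersection p P (ereal (of_rat m))"
proof -
  let ?I = "index_set p P"
  have "\<exists>v. lowest_exponent (coeff P (p ^ i)) v" if "i \<in> ?I" for i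
    using that lowest_exponent_exists by (auto simp: index_set_def)
  then obtain v where v: "\<And>i. i \<in> ?I \<Longrightarrow> lowest_exponent (coeff P (p ^ i)) (v i)"
    by metis
  define g where "g i = v i + of_nat (p ^ i) * m" for i
  have low: "lowest_exponent (coeff P (p ^ i) * y ^ (p ^ i)) (g i)" if "i \<in> ?I" for i
    unfolding g_def by (intro lowest_exponent_mult v lowest_exponent_power y that)
  have val: "monomial_val p P i (ereal (of_rat m)) = ereal (of_rat (g i))" if "i \<in> ?I" for i
    by (simp add: monomial_val_def hahn_val_lowest_exponent[OF v[OF that]] g_def
        of_rat_add of_rat_mult of_rat_power add.commute)
  let ?J = "min_indices p P (ereal (of_rat m))"
  let ?V = "(\<lambda>j. monomial_val p P j (ereal (of_rat m))) ` ?I"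
  have "Min ?V \<in> ?V" using fin ne by (intro Min_in) auto
  then obtain i where i: "i \<in> ?I" "monomial_val p P i (ereal (of_rat m)) = Min ?V" by auto
  then have iJ: "i \<in> ?J" by (simp add: min_indices_def)
  have i_min: "g i \<le> g j" if "j \<in> ?I" for j
  proof -
    have "Min ?V \<le> monomial_val p P j (ereal (of_rat m))" using fin that by (intro Min_le) auto
    then show ?thesis using val[OF that] val[OF i(1)] i(2) by (simp add: of_rat_less_eq)
  qed
  have finJ: "finite ?J" using fin by (auto simp: min_indices_def)
  have "?J \<noteq> {i}"
  proof
    assume J: "?J = {i}"
    have "hahn_coeff (coeff P (p ^ j) * y ^ (p ^ j)) (g i) = 0" if j: "j \<in> ?I - {i}" for j
    proof -
      have "j \<notin> ?J" using J j by auto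
      then have "g j \<noteq> g i" using j i val[of i] val[of j] by (auto simp: min_indices_def)
      then have "g i < g j" using i_min[of j] j by auto
      then show ?thesis using low[of j] j by (force simp: lowest_exponent_def hahn_supp_iff)
    qed
    then have "hahn_coeff (poly P y) (g i) = hahn_coeff (coeff P (p ^ i) * y ^ (p ^ i)) (g i)"
      unfolding powers hahn_coeff_sum using fin i(1) by (subst sum.remove[of _ i]) auto
    then show False
      using low[OF i(1)] root by (simp add: lowest_exponent_def hahn_supp_iff)
  qed
  then obtain j where "j \<in> ?J" "j \<noteq> i" using iJ by blast
  then have "card {i, j} \<le> card ?J" using iJ finJ by (intro card_mono) auto
  then show ?thesis using \<open>j \<noteq> i\<close> by (simp add: point_of_intersection_def)
qed


section \<open>Powers in characteristic \<open>p\<close>\<close>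

lemma of_nat_hahn: "(of_nat n :: 'a::field hahn) = hahn_monom (of_nat n) 0"
  by (rule hahn_eqI, induction n) (auto simp: hahn_coeff_1)

lemma CHAR_hahn: "CHAR('a::field hahn) = CHAR('a)"
proof -
  have "hahn_monom a 0 = 0 \<longleftrightarrow> a = 0" for a :: 'a
  proof
    assume "hahn_monom a 0 = 0"
    then have "hahn_coeff (hahn_monom a 0) 0 = 0" by simp
    then show "a = 0" by simp
  qed (auto intro: hahn_eqI)
  then show ?thesis
    by (intro CHAR_eqI) (auto simp: of_nat_hahn of_nat_eq_0_iff_char_dvd)
qed

lemma hahn_monom_power:
  "hahn_monom a g ^ n = hahn_monom ((a :: 'a::field) ^ n) (of_nat n * g)"
proof (induction n)
  case 0
  then show ?case by (simp add: one_hahn_def)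
next
  case (Suc n)
  then show ?case
    by (intro hahn_eqI) (auto simp: hahn_coeff_monom_mult algebra_simps)
qed

text \<open>
  For bounding the exponents of \<open>x ^ n\<close>: these are sums of \<open>n\<close> exponents of \<open>x\<close>, and \<open>Q k\<close> is a
  property of the sums of \<open>k\<close> of them.
\<close>

lemma hahn_supp_power_induct:
  fixes x :: "'a::field hahn"
  assumes base: "\<And>\<gamma>. \<gamma> \<in> hahn_supp x \<Longrightarrow> Q 1 \<gamma>"
    and step: "\<And>k a b. Q 1 a \<Longrightarrow> Q k b \<Longrightarrow> Q (Suc k) (a + b)"
    and "n > 0" "\<gamma> \<in> hahn_supp (x ^ n)"
  shows "Q n \<gamma>"
  using assms(3,4)
proof (induction n arbitrary: \<gamma> rule: nat_induct_non_zero)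
  case 1
  then show ?case using base by simp
next
  case (Suc n)
  then obtain a b where "\<gamma> = a + b" "a \<in> hahn_supp x" "b \<in> hahn_supp (x ^ n)"
    using hahn_supp_mult[of x "x ^ n"] by (auto simp: sumset_def)
  then show ?case using base step Suc.IH by simp
qed

text \<open>
  Frobenius acts termwise even though the support may be infinite. To read off the coefficient at
  \<open>\<gamma>\<close>, split \<open>x\<close> at the exponent \<open>\<gamma> / p ^ i\<close>: the \<open>p ^ i\<close>-th power of the part below has all its
  exponents below \<open>\<gamma>\<close>, that of the part above has all its exponents above \<open>\<gamma>\<close>, and only the
  single term at \<open>\<gamma> / p ^ i\<close> contributes.
\<close>

lemma hahn_coeff_power_CHAR:
  fixes x :: "'a::field hahn"
  assumes "prime CHAR('a)" and n: "n = CHAR('a) ^ i"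
  shows "hahn_coeff (x ^ n) \<gamma> = hahn_coeff x (\<gamma> / of_nat n) ^ n"
proof -
  have n0: "n > 0" using assms by (simp add: prime_gt_0_nat)
  define c where "c = \<gamma> / of_nat n"
  have c: "of_nat n * c = \<gamma>" using n0 by (simp add: c_def)
  define u where "u = hahn_truncate x c"
  define e where "e = hahn_monom (hahn_coeff x c) c"
  define w where "w = x - u - e"
  have "x ^ n = (u + (e + w)) ^ n" by (simp add: w_def)
  also have "\<dots> = u ^ n + (e ^ n + w ^ n)"
    using assms by (simp add: freshmans_dream' CHAR_hahn)
  finally have split: "x ^ n = u ^ n + (e ^ n + w ^ n)" .
  have "\<gamma> \<notin> hahn_supp (u ^ n)"
  proof
    assume "\<gamma> \<in> hahn_supp (u ^ n)"
    then have "\<gamma> < of_nat n * c"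
      by (intro hahn_supp_power_induct[where Q = "\<lambda>k s. s < of_nat k * c", OF _ _ n0])
        (auto simp: u_def hahn_supp_iff algebra_simps split: if_splits)
    then show False using c by simp
  qed
  moreover have "\<gamma> \<notin> hahn_supp (w ^ n)"
  proof
    assume "\<gamma> \<in> hahn_supp (w ^ n)"
    then have "\<gamma> > of_nat n * c"
      by (intro hahn_supp_power_induct[where Q = "\<lambda>k s. s > of_nat k * c", OF _ _ n0])
        (auto simp: w_def u_def e_def hahn_supp_iff algebra_simps split: if_splits)
    then show False using c by simp
  qed
  moreover have "hahn_coeff (e ^ n) \<gamma> = hahn_coeff x c ^ n"
    by (simp add: e_def hahn_monom_power c)
  ultimately show ?thesis by (simp add: split hahn_supp_iff c_def)
qed


section \<open>Restriction to a set of exponents\<close>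

lift_definition hahn_restrict :: "rat set \<Rightarrow> 'a::zero hahn \<Rightarrow> 'a hahn"
  is "\<lambda>C f \<gamma>. if \<gamma> \<in> C then f \<gamma> else 0"
  by (erule wfp_on_subset) auto

lemma hahn_coeff_restrict [simp]:
  "hahn_coeff (hahn_restrict C x) \<gamma> = (if \<gamma> \<in> C then hahn_coeff x \<gamma> else 0)"
  by transfer simp

lemma hahn_supp_restrict: "hahn_supp (hahn_restrict C x) = hahn_supp x \<inter> C"
  by (auto simp: hahn_supp_iff split: if_splits)

text \<open>
  Only pairs of exponents \<open>\<alpha> + \<beta> = \<gamma>\<close> contribute to the coefficient at \<open>\<gamma>\<close>; for these, \<open>\<beta>\<close> survives
  the restriction of \<open>y\<close> exactly when \<open>\<gamma>\<close> survives that of the product.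
\<close>

lemma hahn_restrict_mult:
  fixes a y :: "'a::field hahn"
  assumes shift: "\<And>h \<gamma>. h \<in> hahn_supp a \<Longrightarrow> h + \<gamma> \<in> C \<longleftrightarrow> \<gamma> \<in> C"
  shows "hahn_restrict C (a * y) = a * hahn_restrict C y"
proof (rule hahn_eqI)
  fix \<gamma>
  have "hahn_coeff (a * hahn_restrict C y) \<gamma> =
      (\<Sum>(\<alpha>, \<beta>) \<in> sum_pairs (hahn_supp a) (hahn_supp y) \<gamma>.
        hahn_coeff a \<alpha> * hahn_coeff (hahn_restrict C y) \<beta>)"
    by (intro hahn_coeff_mult_superset wfp_on_hahn_supp) (auto simp: hahn_supp_restrict)
  also have "\<dots> = (\<Sum>(\<alpha>, \<beta>) \<in> sum_pairs (hahn_supp a) (hahn_supp y) \<gamma>.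
        if \<gamma> \<in> C then hahn_coeff a \<alpha> * hahn_coeff y \<beta> else 0)"
    using shift by (intro sum.cong) (auto simp: sum_pairs_def)
  also have "\<dots> = hahn_coeff (hahn_restrict C (a * y)) \<gamma>"
    by (simp add: hahn_coeff_mult)
  finally show "hahn_coeff (hahn_restrict C (a * y)) \<gamma> = hahn_coeff (a * hahn_restrict C y) \<gamma>" ..
qed

text \<open>
  Each monomial commutes with the restriction: its coefficient by the translation invariance of \<open>C\<close>,
  the power by the termwise action of Frobenius.
\<close>

lemma poly_hahn_restrict:
  fixes P :: "'a::field hahn poly"
  assumes p: "prime CHAR('a)" "p = CHAR('a)"
    and powers: "\<And>y. poly P y = (\<Sum>i\<in>index_set p P. coeff P (p ^ i) * y ^ (p ^ i))"
    and shift: "\<And>n h \<gamma>. h \<in> hahn_supp (coeff P n) \<Longrightarrow> h + \<gamma> \<in> C \<longleftrightarrow> \<gamma> \<in> C"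
    and scale: "\<And>i \<gamma>. \<gamma> / of_nat (p ^ i) \<in> C \<longleftrightarrow> \<gamma> \<in> C"
  shows "poly P (hahn_restrict C x) = hahn_restrict C (poly P x)"
proof -
  have "hahn_restrict C x ^ (p ^ i) = hahn_restrict C (x ^ (p ^ i))" for i
    by (rule hahn_eqI)
      (use p scale[of _ i] in \<open>simp add: hahn_coeff_power_CHAR[where i = i] prime_gt_0_nat del: of_nat_power\<close>)
  then have "coeff P (p ^ i) * hahn_restrict C x ^ (p ^ i) =
      hahn_restrict C (coeff P (p ^ i) * x ^ (p ^ i))" for i
    using hahn_restrict_mult[of "coeff P (p ^ i)" C] shift by simp
  then show ?thesis
    unfolding powers by (intro hahn_eqI) (simp add: sum.neutral)
qed


section \<open>Rational functions have integral support\<close>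

text \<open>
  The restriction of the inverse to the integers is another inverse, as multiplication by a series
  with integral support commutes with that restriction.
\<close>

lemma integral_supp_inverse:
  fixes x :: "'a::field hahn"
  assumes "hahn_supp x \<subseteq> \<int>"
  shows "hahn_supp (inverse x) \<subseteq> \<int>"
proof (cases "x = 0")
  case True
  then show ?thesis by (simp add: hahn_supp_def)
next
  case False
  have "x * hahn_restrict \<int> (inverse x) = hahn_restrict \<int> (x * inverse x)"
  proof (rule hahn_restrict_mult[symmetric])
    fix h \<gamma> assume "h \<in> hahn_supp x"
    then have "h \<in> \<int>" using assms by auto
    then show "h + \<gamma> \<in> \<int> \<longleftrightarrow> \<gamma> \<in> \<int>" using Ints_diff[of "h + \<gamma>" h] by auto
  qed
  also have "x * inverse x = 1" using False by simp
  also have "hahn_restrict \<int> (1 :: 'a hahn) = 1" by (rule hahn_eqI) (simp add: hahn_coeff_1)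
  finally have "inverse x = hahn_restrict \<int> (inverse x)" by (rule inverse_unique)
  then show ?thesis by (metis hahn_supp_restrict inf_le2)
qed

lemma integral_supp_mult:
  fixes x y :: "'a::field hahn"
  assumes "hahn_supp x \<subseteq> \<int>" "hahn_supp y \<subseteq> \<int>"
  shows "hahn_supp (x * y) \<subseteq> \<int>"
  using hahn_supp_mult[of x y] assms by (force simp: sumset_def)

lemma integral_supp_of_int: "hahn_supp (of_int k :: 'a::field hahn) \<subseteq> \<int>"
  by (cases k) (auto simp: hahn_supp_iff of_nat_hahn hahn_coeff_1 split: if_splits)

lemma integral_supp_poly:
  fixes f :: "'a::field hahn poly"
  assumes "\<And>i. hahn_supp (coeff f i) \<subseteq> \<int>" "hahn_supp x \<subseteq> \<int>"
  shows "hahn_supp (poly f x) \<subseteq> \<int>"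
  using assms(1)
proof (induction f)
  case 0
  then show ?case by (simp add: hahn_supp_def)
next
  case (pCons a f)
  have "hahn_supp a \<subseteq> \<int>" using pCons.prems[of 0] by simp
  moreover have "hahn_supp (coeff f i) \<subseteq> \<int>" for i using pCons.prems[of "Suc i"] by simp
  then have "hahn_supp (x * poly f x) \<subseteq> \<int>" using pCons.IH assms(2) integral_supp_mult by blast
  moreover have "hahn_supp (a + x * poly f x) \<subseteq> hahn_supp a \<union> hahn_supp (x * poly f x)"
    by (auto simp: hahn_supp_iff)
  ultimately show ?case by auto
qed

lemma integral_supp_Fp_t:
  fixes a :: "'a::field hahn"
  assumes "a \<in> Fp_t"
  shows "hahn_supp a \<subseteq> \<int>"
proof -
  obtain f g where a: "a = poly f hahn_t / poly g hahn_t"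
    and fg: "\<And>i. coeff f i \<in> \<int>" "\<And>i. coeff g i \<in> \<int>"
    using assms by (auto simp: Fp_t_def)
  have t: "hahn_supp (hahn_t :: 'a hahn) \<subseteq> \<int>"
    by (auto simp: hahn_t_def hahn_supp_iff split: if_splits)
  have Ints: "hahn_supp b \<subseteq> \<int>" if "b \<in> \<int>" for b :: "'a hahn"
    using that integral_supp_of_int by (auto elim!: Ints_cases)
  show ?thesis
    unfolding a divide_inverse
    by (intro integral_supp_mult integral_supp_inverse integral_supp_poly t Ints fg)
qed


section \<open>Exponents of additive polynomials\<close>

lemma coeff_one_plus_monom_power:
  assumes "d > 0"
  shows "coeff ((1 + monom 1 d :: 'b::comm_ring_1 poly) ^ n) (d * k) = of_nat (n choose k)"
proof -
  have "(1 + monom 1 d :: 'b poly) ^ n = (\<Sum>j\<le>n. monom (of_nat (n choose j)) (d * j))"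
    unfolding add.commute[of 1 "monom 1 d :: 'b poly"]
    by (simp add: binomial_ring monom_power of_nat_poly smult_monom mult.commute)
  then have "coeff ((1 + monom 1 d :: 'b poly) ^ n) (d * k) =
      (\<Sum>j\<le>n. if j = k then of_nat (n choose j) else 0)"
    using assms by (simp add: coeff_sum)
  also have "\<dots> = of_nat (n choose k)"
    by (auto simp: binomial_eq_0)
  finally show ?thesis .
qed

text \<open>
  Compare the coefficients in
  \<open>(1 + X) ^ (p ^ a * m) = (1 + X ^ (p ^ a)) ^ m\<close>, an identity of polynomials in characteristic \<open>p\<close>.
\<close>

lemma of_nat_choose_CHAR_power:
  assumes "prime CHAR('b::comm_ring_1)" "p = CHAR('b)"
  shows "(of_nat ((p ^ a * m) choose (p ^ a)) :: 'b) = of_nat m"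
proof -
  have "((1 + monom 1 1 :: 'b poly) ^ (p ^ a)) ^ m = (1 + monom 1 (p ^ a)) ^ m"
    using assms by (simp add: freshmans_dream' monom_power)
  then have eq: "(1 + monom 1 1 :: 'b poly) ^ (p ^ a * m) = (1 + monom 1 (p ^ a)) ^ m"
    by (simp add: power_mult)
  have "(of_nat ((p ^ a * m) choose (p ^ a)) :: 'b) =
      coeff ((1 + monom 1 1 :: 'b poly) ^ (p ^ a * m)) (1 * p ^ a)"
    by (rule coeff_one_plus_monom_power[symmetric]) simp
  also have "\<dots> = coeff ((1 + monom 1 (p ^ a) :: 'b poly) ^ m) (p ^ a * 1)"
    by (simp only: eq mult_1 mult_1_right)
  also have "\<dots> = of_nat (m choose 1)"
    by (rule coeff_one_plus_monom_power) (use assms prime_gt_0_nat in auto)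
  finally show ?thesis by simp
qed

text \<open>
  The outer variable is \<open>Y\<close> and the inner one \<open>X\<close>, so this is the binomial theorem read off at
  \<open>X ^ j * Y ^ k\<close>.
\<close>

lemma coeff_pcompose_X_plus_Y:
  fixes P :: "'b::comm_ring_1 poly"
  shows "coeff (coeff (pcompose (map_poly (\<lambda>a. [:a:]) P) [:[:0, 1:], 1:]) k) j =
    of_nat ((j + k) choose k) * coeff P (j + k)"
proof -
  let ?L = "map_poly (\<lambda>a. [:a:]) P" and ?q = "[:[:0, 1:], 1:] :: 'b poly poly"
  have q: "coeff (coeff (?q ^ n) k) j = (if n = j + k then of_nat (n choose k) else 0)" for n
  proof (cases "k \<le> n")
    case True
    have "[:0, 1:] = (monom 1 1 :: 'b poly)" by (simp add: monom_altdef)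
    then have "coeff (?q ^ n) k = monom (of_nat (n choose k)) (n - k)"
      using True by (simp add: coeff_linear_poly_power monom_power of_nat_poly smult_monom)
    then show ?thesis using True by auto
  next
    case False
    have "degree (?q ^ n) \<le> degree ?q * n" by (rule degree_power_le)
    then have "coeff (?q ^ n) k = 0" using False by (intro coeff_eq_0) simp
    then show ?thesis using False by simp
  qed
  have "pcompose ?L ?q = (\<Sum>n\<le>degree P. smult [:coeff P n:] (?q ^ n))"
    by (simp add: pcompose_altdef poly_altdef coeff_map_poly degree_map_poly)
  then have "coeff (coeff (pcompose ?L ?q) k) j =
      (\<Sum>n\<le>degree P. if n = j + k then of_nat (n choose k) * coeff P n else 0)"
    by (simp add: coeff_sum q if_distrib mult.commute cong: if_cong)
  also have "\<dots> = of_nat ((j + k) choose k) * coeff P (j + k)"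
    by (auto simp: coeff_eq_0)
  finally show ?thesis .
qed

text \<open>
  If \<open>n = p ^ a * m\<close> with \<open>m > 1\<close> prime to \<open>p\<close>, then the mixed monomial
  \<open>X ^ (n - p ^ a) * Y ^ (p ^ a)\<close> occurs in \<open>(X + Y) ^ n\<close> with the invertible coefficient \<open>m\<close>.
\<close>

lemma additive_poly_coeff_eq_0:
  fixes P :: "'b::field poly"
  assumes p: "prime CHAR('b)" "p = CHAR('b)"
    and P: "additive_poly P" and n: "\<And>i. n \<noteq> p ^ i"
  shows "coeff P n = 0"
proof -
  have eq: "of_nat ((j + k) choose k) * coeff P (j + k) =
      coeff (coeff ([:P:] + map_poly (\<lambda>a. [:a:]) P) k) j" for j k
    using P coeff_pcompose_X_plus_Y[of P k j] unfolding additive_poly_def by simp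
  show ?thesis
  proof (cases "n = 0")
    case True
    have "coeff P 0 = 0 \<or> (2 :: 'b) = 1" using eq[of 0 0] by (simp add: coeff_map_poly)
    then show ?thesis using True by (metis add_cancel_right_right one_add_one zero_neq_one)
  next
    case False
    have "\<not> is_unit p" using p by auto
    then obtain m where m: "n = p ^ multiplicity p n * m" "\<not> p dvd m"
      using False by (metis multiplicity_decompose')
    define a where "a = multiplicity p n"
    have n_eq: "n = p ^ a * m" using m by (simp add: a_def)
    have "m \<noteq> 1" using n[of a] n_eq by auto
    moreover have "m \<noteq> 0" using False n_eq by auto
    ultimately have "m > 1" by simp
    have pa: "0 < p ^ a" using p prime_gt_0_nat by simp
    then have lt: "p ^ a < n" using \<open>m > 1\<close> n_eq by simp
    then have "of_nat (n choose (p ^ a)) * coeff P n = 0"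
      using eq[of "n - p ^ a" "p ^ a"] pa
      by (auto simp: coeff_map_poly coeff_pCons split: nat.splits)
    moreover have "of_nat (n choose (p ^ a)) = (of_nat m :: 'b)"
      unfolding n_eq using p by (rule of_nat_choose_CHAR_power)
    moreover have "of_nat m \<noteq> (0 :: 'b)" using m p by (simp add: of_nat_eq_0_iff_char_dvd)
    ultimately show ?thesis by simp
  qed
qed

lemma finite_index_set:
  assumes "p > 1"
  shows "finite (index_set p P)"
proof (rule finite_subset)
  show "index_set p P \<subseteq> {..degree P}"
  proof
    fix i assume "i \<in> index_set p P"
    then have "p ^ i \<le> degree P" by (simp add: index_set_def le_degree)
    then show "i \<in> {..degree P}" using power_gt_expt[of p i] assms by simp
  qed
qed simp

lemma poly_eq_sum_index_set:
  fixes P :: "'a::field hahn poly"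
  assumes p: "p > 1" and P: "\<And>n. coeff P n \<noteq> 0 \<Longrightarrow> \<exists>i. n = p ^ i"
  shows "poly P y = (\<Sum>i\<in>index_set p P. coeff P (p ^ i) * y ^ (p ^ i))"
proof -
  have inj: "inj_on (\<lambda>i. p ^ i) (index_set p P)" using p by (auto simp: inj_on_def)
  have "poly P y = (\<Sum>n\<in>(\<lambda>i. p ^ i) ` index_set p P. coeff P n * y ^ n)"
    unfolding poly_altdef
    by (rule sum.mono_neutral_right) (use P in \<open>auto simp: index_set_def le_degree\<close>)
  then show ?thesis by (simp add: sum.reindex[OF inj])
qed


section \<open>Denominators divisible by a power of \<open>q\<close>\<close>

definition denom_power_dvd :: "nat \<Rightarrow> nat \<Rightarrow> rat set"
  where "denom_power_dvd q K = {s. \<exists>k\<ge>K. has_exact_denom_power q k s}"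

text \<open>
  In \<open>n + a / (b * q ^ k) = (a + q ^ k * b * n) / (b * q ^ k)\<close> the new numerator is congruent to
  \<open>a\<close> modulo \<open>q\<close> because \<open>k > 0\<close>.
\<close>

lemma has_exact_denom_power_add_int:
  assumes "q > 1" "k > 0" "has_exact_denom_power q k s"
  shows "has_exact_denom_power q k (of_int n + s)"
proof -
  obtain a b where ab: "coprime a (int q)" "coprime b (int q)"
    "s = of_int a / (of_int b * of_nat q ^ k)"
    using assms(3) unfolding has_exact_denom_power_def by blast
  have "b \<noteq> 0" using ab(2) assms(1) by auto
  let ?a = "a + int q ^ k * b * n"
  have "int q ^ k * b * n = int q * (int q ^ (k - 1) * b * n)"
    using assms(2) by (cases k) auto
  then have "coprime ?a (int q)" using ab(1)
    by (metis coprime_iff_gcd_eq_1 gcd.commute gcd_add_mult mult.commute add.commute)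
  moreover have "of_int n + s = of_int ?a / (of_int b * of_nat q ^ k)"
    using \<open>b \<noteq> 0\<close> assms(1) by (simp add: ab(3) field_simps)
  ultimately show ?thesis using ab(2) unfolding has_exact_denom_power_def by blast
qed

lemma denom_power_dvd_add_int:
  assumes "q > 1" "K > 0" "h \<in> \<int>"
  shows "h + s \<in> denom_power_dvd q K \<longleftrightarrow> s \<in> denom_power_dvd q K"
proof -
  obtain n where n: "h = of_int n" using assms(3) by (auto elim: Ints_cases)
  have "of_int n + s \<in> denom_power_dvd q K" if s: "s \<in> denom_power_dvd q K" for n s
  proof -
    obtain k where "k \<ge> K" "has_exact_denom_power q k s"
      using s unfolding denom_power_dvd_def by blast
    then have "has_exact_denom_power q k (of_int n + s)"
      using assms(1,2) by (intro has_exact_denom_power_add_int) auto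
    then show ?thesis using \<open>k \<ge> K\<close> unfolding denom_power_dvd_def by blast
  qed
  from this[of s n] this[of "h + s" "- n"] show ?thesis by (auto simp: n)
qed

lemma denom_power_dvd_divide:
  assumes "coprime c q" "c > 0"
  shows "s / of_nat c \<in> denom_power_dvd q K \<longleftrightarrow> s \<in> denom_power_dvd q K"
proof -
  have c: "coprime (int c) (int q)" using assms(1) by simp
  have "has_exact_denom_power q k (s / of_nat c)" if s: "has_exact_denom_power q k s" for k
  proof -
    obtain a b where "coprime a (int q)" "coprime b (int q)"
      "s = of_int a / (of_int b * of_nat q ^ k)"
      using s unfolding has_exact_denom_power_def by blast
    then show ?thesis unfolding has_exact_denom_power_def
      by (intro exI[of _ a] exI[of _ "b * int c"]) (use c in \<open>simp add: mult_ac\<close>)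
  qed
  moreover have "has_exact_denom_power q k s" if s: "has_exact_denom_power q k (s / of_nat c)" for k
  proof -
    obtain a b where ab: "coprime a (int q)" "coprime b (int q)"
      "s / of_nat c = of_int a / (of_int b * of_nat q ^ k)"
      using s unfolding has_exact_denom_power_def by blast
    have "s = of_int (a * int c) / (of_int b * of_nat q ^ k)"
      using ab(3) assms(2) by (simp add: nonzero_divide_eq_eq)
    then show ?thesis using ab c unfolding has_exact_denom_power_def
      by (intro exI[of _ "a * int c"] exI[of _ b]) simp
  qed
  ultimately show ?thesis by (auto simp: denom_power_dvd_def)
qed


section \<open>Ramification of roots\<close>

text \<open>
  Ramification provides an exact power of \<open>q\<close> in the denominator of \<open>r\<close> that, like all higher
  powers, does not occur in the support below \<open>r\<close>.
\<close>

lemma ramifies_at_lowest_exponent: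
  assumes "ramifies_at q r x"
  obtains K where "K > 0" "lowest_exponent (hahn_restrict (denom_power_dvd q K) x) r"
proof -
  obtain K where K: "K > 0" "has_exact_denom_power q K r"
    "\<And>k s. k \<ge> K \<Longrightarrow> s \<in> hahn_supp (hahn_truncate x r) \<Longrightarrow> \<not> has_exact_denom_power q k s"
    and r: "r \<in> hahn_supp x"
    using assms by (auto simp: ramifies_at_def)
  have "r \<le> s" if "s \<in> hahn_supp x" "s \<in> denom_power_dvd q K" for s
  proof (rule ccontr)
    assume "\<not> r \<le> s"
    then have "s \<in> hahn_supp (hahn_truncate x r)" using that by (simp add: hahn_supp_iff)
    then show False using K(3) that by (auto simp: denom_power_dvd_def)
  qed
  then have "lowest_exponent (hahn_restrict (denom_power_dvd q K) x) r"
    using K r by (auto simp: lowest_exponent_def hahn_supp_restrict denom_power_dvd_def)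
  with K(1) show ?thesis by (rule that)
qed

theorem theorem5p3:
  fixes p q :: nat and P :: "'a::field hahn poly" and x :: "'a hahn" and r :: rat
  assumes "CHAR('a) = p" and "p > 0"
    and "\<And>i. coeff P i \<in> Fp_t"
    and "P \<noteq> 0"
    and "additive_poly P"
    and "prime q" and "q \<noteq> p"
    and "poly P x = 0"
    and "ramifies_at q r x"
  shows "point_of_intersection p P (ereal (of_rat r))"
proof -
  have prime: "prime CHAR('a)" and p: "p = CHAR('a)"
    using assms(1,2) prime_CHAR_semidom by auto
  then have p1: "p > 1" using prime_gt_1_nat by simp
  have supp: "\<exists>i. n = p ^ i" if "coeff P n \<noteq> 0" for n
    using that additive_poly_coeff_eq_0[of p P n] prime p assms(5) by (auto simp: CHAR_hahn)
  note powers = poly_eq_sum_index_set[OF p1 supp]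
  have "\<exists>n. coeff P n \<noteq> 0" using assms(4) by (simp add: poly_eq_iff)
  then have ne: "index_set p P \<noteq> {}" using supp by (auto simp: index_set_def)
  obtain K where K: "K > 0" "lowest_exponent (hahn_restrict (denom_power_dvd q K) x) r"
    using ramifies_at_lowest_exponent[OF assms(9)] .
  let ?C = "denom_power_dvd q K"
  have "coprime (p ^ i) q" for i
    using primes_coprime[of p q] prime p assms(6,7) by simp
  then have scale: "\<gamma> / of_nat (p ^ i) \<in> ?C \<longleftrightarrow> \<gamma> \<in> ?C" for i \<gamma>
    using p1 by (intro denom_power_dvd_divide) auto
  have shift: "h + \<gamma> \<in> ?C \<longleftrightarrow> \<gamma> \<in> ?C" if "h \<in> hahn_supp (coeff P n)" for n h \<gamma>
    using that integral_supp_Fp_t[OF assms(3)] K(1) prime_gt_1_nat[OF assms(6)]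
    by (intro denom_power_dvd_add_int) auto
  have "poly P (hahn_restrict ?C x) = hahn_restrict ?C (poly P x)"
    by (rule poly_hahn_restrict[OF prime p powers shift scale])
  then have "poly P (hahn_restrict ?C x) = 0"
    using assms(8) by (auto intro: hahn_eqI)
  then show ?thesis
    by (intro point_of_intersection_root[OF powers finite_index_set[OF p1] ne _ K(2)])
qed

end
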